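(* Let $\mathbb P=\langle P,<\rangle$ be a strict partial order of regular cardinality $\kappa\geq\omega$ satisfying (u1) for all $L,G\in[P]^{<\kappa}\setminus\{\emptyset\}$, if $L<G$ then there is $p\in P$ such that $L<p<G$; (u2) for every $K\in[P]^{<\kappa}\setminus\{\emptyset\}$ there are $p,q,r\in P$ such that $p<K$, $q>K$ and $r\parallel K$. Then $\mathbb P$ is not reversible.
   Context: $[P]^{<\kappa}$ is the set of subsets of $P$ of size less than $\kappa$. For $p,q\in P$, $p\parallel q$ means that $p$ and $q$ are incomparable, i.e. $p\not\leq q$ and $q\not\leq p$ (where $\leq$ is the reflexive closure of $<$). For $A,B\subset P$, $A<B$ means $a<b$ for all $a\in A$, $b\in B$; $A\parallel B$ is defined similarly; an element $p$ in such an expression stands for $\{p\}$. A (strict) partial order $\langle P,<\rangle$ is reversible iff each bijection $f:P\to P$ such that $x<y\Rightarrow f(x)<f(y)$ for all $x,y\in P$ is an automorphism of $\langle P,<\rangle$. *)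

theory Defs
  imports Main
begin

unbundle cardinal_syntax

text \<open>Throughout, a structure is a carrier set \<open>P\<close> with a relation \<open>lt\<close>; only the restriction of
  \<open>lt\<close> to \<open>P\<close> is relevant.\<close>

definition strict_partial_order :: "'a set \<Rightarrow> ('a \<Rightarrow> 'a \<Rightarrow> bool) \<Rightarrow> bool" where
  "strict_partial_order P lt \<longleftrightarrow> irreflp_on P lt \<and> transp_on P lt"

definition incomparable :: "('a \<Rightarrow> 'a \<Rightarrow> bool) \<Rightarrow> 'a \<Rightarrow> 'a \<Rightarrow> bool" where
  "incomparable lt p q \<longleftrightarrow> \<not> lt\<^sup>=\<^sup>= p q \<and> \<not> lt\<^sup>=\<^sup>= q p"

definition setwise :: "('a \<Rightarrow> 'a \<Rightarrow> bool) \<Rightarrow> 'a set \<Rightarrow> 'a set \<Rightarrow> bool" where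
  "setwise R A B \<longleftrightarrow> (\<forall>a\<in>A. \<forall>b\<in>B. R a b)"

text \<open>The cardinal \<open>\<kappa>\<close> is represented by a well-order (see \<^const>\<open>Card_order\<close>), on a type of its own.\<close>

definition subsets_less :: "'a set \<Rightarrow> 'k rel \<Rightarrow> 'a set set" where
  "subsets_less P \<kappa> = {A. A \<subseteq> P \<and> |A| <o \<kappa>}"

definition automorphism :: "'a set \<Rightarrow> ('a \<Rightarrow> 'a \<Rightarrow> bool) \<Rightarrow> ('a \<Rightarrow> 'a) \<Rightarrow> bool" where
  "automorphism P lt f \<longleftrightarrow> bij_betw f P P \<and> (\<forall>x\<in>P. \<forall>y\<in>P. lt x y \<longleftrightarrow> lt (f x) (f y))"

definition reversible :: "'a set \<Rightarrow> ('a \<Rightarrow> 'a \<Rightarrow> bool) \<Rightarrow> bool" where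
  "reversible P lt \<longleftrightarrow>
     (\<forall>f. bij_betw f P P \<and> (\<forall>x\<in>P. \<forall>y\<in>P. lt x y \<longrightarrow> lt (f x) (f y)) \<longrightarrow> automorphism P lt f)"

end

theory Submission
  imports Defs
begin

text \<open>A bijection \<open>f\<close> is built by back-and-forth along a well-order of \<open>P\<close>, through partial injections
  that preserve \<open><\<close> but need not reflect it. To put a new point \<open>x\<close> into the domain, its cut is
  transported by \<open>f\<close>, and (u1), (u2) realise the image cut outside the current range. To put
  a new point into the range, take as its preimage a point incomparable to the whole current domain, on
  which nothing has to be preserved. Since reflection is never required, one can start with
  \<open>b \<mapsto> c\<close>, \<open>d \<mapsto> d\<close> for incomparable \<open>b, d\<close> and \<open>c < d\<close>.\<close>

section \<open>Recursion along a well-order of \<open>P\<close> by finite steps\<close>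

lemma finite_card_less_infinite:
  "finite A \<Longrightarrow> infinite B \<Longrightarrow> |A| <o |B|"
  by (rule finite_ordLess_infinite[OF card_of_Well_order card_of_Well_order]) (auto simp: Field_card_of)

text \<open>The points of \<open>P\<close> are treated in turn along the cardinal well-order
  \<open>|P|\<close>. Proper initial segments are smaller than \<open>|P|\<close> and each turn adds
  a finite set, so fewer than \<open>|P|\<close> elements are present whenever \<open>extend\<close>
  is invoked. Since \<open>R\<close> constrains only two elements at a time, it survives unions of
  chains.\<close>

lemma transfinite_pairwise_extension:
  fixes P :: "'a set" and R :: "'b \<Rightarrow> 'b \<Rightarrow> bool" and Q :: "'a \<Rightarrow> 'b set \<Rightarrow> bool"
  assumes inf: "infinite P" and fin: "finite F0"
    and extend: "\<And>x F. x \<in> P \<Longrightarrow> F0 \<subseteq> F \<Longrightarrow> setwise R F F \<Longrightarrow> |F| <o |P|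
      \<Longrightarrow> \<exists>S. finite S \<and> setwise R (F \<union> S) (F \<union> S) \<and> Q x S"
    and base: "setwise R F0 F0"
  shows "\<exists>F. F0 \<subseteq> F \<and> setwise R F F \<and> (\<forall>x\<in>P. \<exists>S\<subseteq>F. Q x S)"
proof -
  let ?r = "|P|"
  have wo: "wo_rel ?r"
    by (simp add: wo_rel_def card_of_Well_order)
  \<comment> \<open>\<open>stage f x\<close> is what has been collected before the turn of
    \<open>x\<close>. The recursion assigns a value to every element of the type, hence
    \<open>good\<close> is vacuous outside \<open>P\<close>.\<close>
  define stage where "stage f x = F0 \<union> \<Union> (f ` underS ?r x)" for f :: "'a \<Rightarrow> 'b set" and x
  define good where "good f x S \<longleftrightarrow>
      (x \<in> P \<longrightarrow> finite S \<and> setwise R (stage f x \<union> S) (stage f x \<union> S) \<and> Q x S)"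
    for f :: "'a \<Rightarrow> 'b set" and x S
  \<comment> \<open>Of two indices, the later one, \<open>z\<close>, has both values inside
    \<open>stage f z \<union> f z\<close>. Two members of \<open>F0\<close> are excluded because
    \<open>A\<close> may be empty; \<open>base\<close> handles them.\<close>
  have chain: "\<exists>z\<in>A. u \<in> stage f z \<union> f z \<and> v \<in> stage f z \<union> f z"
    if uv: "u \<in> F0 \<union> \<Union> (f ` A)" "v \<in> F0 \<union> \<Union> (f ` A)" "\<not> (u \<in> F0 \<and> v \<in> F0)"
      and A: "A \<subseteq> P"
    for f :: "'a \<Rightarrow> 'b set" and A u v
  proof -
    have later: "f y \<subseteq> stage f z \<union> f z" if "(y, z) \<in> ?r" for y z
      using that by (auto simp: stage_def underS_def)
    have total: "(y, z) \<in> ?r \<or> (z, y) \<in> ?r" if "y \<in> P" "z \<in> P" for y z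
      using that wo_rel.TOTALS[OF wo] by (simp add: Field_card_of)
    have "F0 \<subseteq> stage f z" for z
      by (auto simp: stage_def)
    moreover obtain y z where "y \<in> A" "z \<in> A" "u \<in> F0 \<union> f y" "v \<in> F0 \<union> f z"
      using uv by (cases "u \<in> F0"; cases "v \<in> F0") blast+
    moreover from this have "(y, z) \<in> ?r \<or> (z, y) \<in> ?r"
      using total A by blast
    ultimately show ?thesis
      using later by blast
  qed
  have "\<exists>f. \<forall>x. good f x (f x)"
  proof (rule dependent_wf_choice[of "?r - Id"])
    show "wf (?r - Id)"
      by (rule wo_rel.WF[OF wo])
  next
    fix f g :: "'a \<Rightarrow> 'b set" and x S
    assume "\<And>z. (z, x) \<in> ?r - Id \<Longrightarrow> f z = g z"
    then have "f ` underS ?r x = g ` underS ?r x"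
      by (intro image_cong) (auto simp: underS_def)
    then show "good f x S = good g x S"
      by (simp add: good_def stage_def)
  next
    fix x and f :: "'a \<Rightarrow> 'b set"
    assume IH: "\<And>y. (y, x) \<in> ?r - Id \<Longrightarrow> good f y (f y)"
    show "\<exists>S. good f x S"
    proof (cases "x \<in> P")
      case True
      have sub: "underS ?r x \<subseteq> P"
        by (auto simp: underS_def Field_card_of dest: FieldI1)
      have good: "finite (f y)" "setwise R (stage f y \<union> f y) (stage f y \<union> f y)"
        if "y \<in> underS ?r x" for y
        using IH[of y] that sub by (auto simp: good_def underS_def)
      have small: "|underS ?r x| <o |P|"
        using True by (intro card_of_underS) (auto simp: card_of_card_order_on Field_card_of)
      have "|\<Union> (f ` underS ?r x)| <o |P|"
      \<comment> \<open>A finite union of finite sets is finite; over an infinite index set, such a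
        union is no larger than the index set.\<close>
      proof (cases "finite (underS ?r x)")
        case True
        then have "finite (\<Union> (f ` underS ?r x))"
          using good by simp
        then show ?thesis
          by (simp add: finite_card_less_infinite inf)
      next
        case False
        have "|\<Union> (f ` underS ?r x)| \<le>o |underS ?r x|"
        proof (rule card_of_UNION_ordLeq_infinite[OF False])
          show "\<forall>i\<in>underS ?r x. |f i| \<le>o |underS ?r x|"
            using good False by (simp add: finite_card_less_infinite ordLess_imp_ordLeq)
        qed (rule card_of_mono1[OF subset_refl])
        then show ?thesis
          using small ordLeq_ordLess_trans by blast
      qed
      then have "|stage f x| <o |P|"
        unfolding stage_def using inf fin
        by (simp add: card_of_Un_ordLess_infinite finite_card_less_infinite)
      moreover have "setwise R (stage f x) (stage f x)"
        unfolding setwise_def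
      proof (intro ballI)
        fix u v assume "u \<in> stage f x" "v \<in> stage f x"
        then show "R u v"
        proof (cases "u \<in> F0 \<and> v \<in> F0")
          case True
          then show ?thesis
            using base by (simp add: setwise_def)
        next
          case False
          with \<open>u \<in> stage f x\<close> \<open>v \<in> stage f x\<close>
          obtain z where "z \<in> underS ?r x" "u \<in> stage f z \<union> f z" "v \<in> stage f z \<union> f z"
            using chain[of u f "underS ?r x" v] sub by (auto simp only: stage_def)
          then show ?thesis
            using good(2) unfolding setwise_def by blast
        qed
      qed
      ultimately show ?thesis
        using extend[of x "stage f x"] True by (auto simp: good_def stage_def)
    qed (simp add: good_def)
  qed
  then obtain f where f: "\<And>x. good f x (f x)"
    by blast
  let ?F = "F0 \<union> \<Union> (f ` P)"
  have "setwise R ?F ?F"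
    unfolding setwise_def
  proof (intro ballI)
    fix u v assume "u \<in> ?F" "v \<in> ?F"
    then show "R u v"
    proof (cases "u \<in> F0 \<and> v \<in> F0")
      case True
      then show ?thesis
        using base by (simp add: setwise_def)
    next
      case False
      with \<open>u \<in> ?F\<close> \<open>v \<in> ?F\<close>
      obtain z where "z \<in> P" "u \<in> stage f z \<union> f z" "v \<in> stage f z \<union> f z"
        using chain[of u f P v] by auto
      then show ?thesis
        using f[of z] unfolding good_def setwise_def by blast
    qed
  qed
  moreover have "\<forall>x\<in>P. \<exists>S\<subseteq>?F. Q x S"
    using f unfolding good_def by blast
  ultimately show ?thesis
    by blast
qed

section \<open>One-point extensions of partial injections\<close>

text \<open>A set of pairs is the graph of a partial injection preserving \<open>lt\<close> iff any two of its members are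
  related as follows.\<close>

definition hom_pair :: "'a set \<Rightarrow> ('a \<Rightarrow> 'a \<Rightarrow> bool) \<Rightarrow> 'a \<times> 'a \<Rightarrow> 'a \<times> 'a \<Rightarrow> bool" where
  "hom_pair P lt u v \<longleftrightarrow> u \<in> P \<times> P \<and> (fst u = fst v \<longleftrightarrow> snd u = snd v)
     \<and> (lt (fst u) (fst v) \<longrightarrow> lt (snd u) (snd v))"

text \<open>Fresh coordinates make both sides of the biconditional in \<open>hom_pair\<close> false;
  irreflexivity settles the new pair against itself.\<close>

lemma setwise_hom_pair_insert:
  assumes "setwise (hom_pair P lt) F F" "irreflp_on P lt" "x \<in> P" "y \<in> P"
    and "\<And>a b. (a, b) \<in> F \<Longrightarrow> a \<noteq> x \<and> b \<noteq> y \<and> (lt a x \<longrightarrow> lt b y) \<and> (lt x a \<longrightarrow> lt y b)"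
  shows "setwise (hom_pair P lt) (insert (x, y) F) (insert (x, y) F)"
  using assms unfolding setwise_def hom_pair_def irreflp_on_def by fastforce

text \<open>Only the points comparable to \<open>x\<close> constrain its image: \<open>y\<close> has
  to lie above \<open>?L\<close>, below \<open>?G\<close>, and outside the range of
  \<open>F\<close>.\<close>

lemma hom_pair_forth:
  assumes hom: "setwise (hom_pair P lt) F F" and card: "|F| <o |P|" and inf: "infinite P"
    and irrefl: "irreflp_on P lt" and trans: "transp_on P lt"
    and between: "\<And>L G. L \<subseteq> P \<Longrightarrow> G \<subseteq> P \<Longrightarrow> |L| <o |P| \<Longrightarrow> |G| <o |P| \<Longrightarrow> L \<noteq> {} \<Longrightarrow> G \<noteq> {}
      \<Longrightarrow> setwise lt L G \<Longrightarrow> \<exists>p\<in>P. setwise lt L {p} \<and> setwise lt {p} G"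
    and below: "\<And>K. K \<subseteq> P \<Longrightarrow> |K| <o |P| \<Longrightarrow> K \<noteq> {} \<Longrightarrow> \<exists>p\<in>P. setwise lt {p} K"
    and above: "\<And>K. K \<subseteq> P \<Longrightarrow> |K| <o |P| \<Longrightarrow> K \<noteq> {} \<Longrightarrow> \<exists>p\<in>P. setwise lt K {p}"
    and x: "x \<in> P"
  shows "\<exists>y. setwise (hom_pair P lt) (insert (x, y) F) (insert (x, y) F)"
proof (cases "x \<in> fst ` F")
  case True
  then obtain y where "(x, y) \<in> F"
    by force
  with hom show ?thesis
    by (metis insert_absorb)
next
  case False
  have FP: "F \<subseteq> P \<times> P"
    using hom by (auto simp: setwise_def hom_pair_def)
  \<comment> \<open>Adding \<open>x\<close> to the range makes \<open>?B\<close> nonempty even when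
    \<open>F\<close> is empty, so that \<open>below\<close> and \<open>above\<close> apply.\<close>
  let ?B = "insert x (snd ` F)"
  let ?L = "snd ` {u \<in> F. lt (fst u) x}" and ?G = "snd ` {u \<in> F. lt x (fst u)}"
  have B: "?B \<subseteq> P"
    using FP x by auto
  have "|snd ` F| <o |P|"
    using card card_of_image ordLeq_ordLess_trans by blast
  then have "|{x} \<union> snd ` F| <o |P|"
    using inf by (intro card_of_Un_ordLess_infinite) (auto simp: finite_card_less_infinite)
  then have small: "|A| <o |P|" if "A \<subseteq> ?B" for A
    using that card_of_mono1[of A ?B] ordLeq_ordLess_trans by auto
  \<comment> \<open>If \<open>a < x < a'\<close>, then \<open>a < a'\<close> by transitivity, and
    \<open>F\<close> carries this over to the images.\<close>
  have LG: "setwise lt ?L ?G"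
    unfolding setwise_def
  proof (intro ballI)
    fix b b' assume "b \<in> ?L" "b' \<in> ?G"
    then obtain a a' where "(a, b) \<in> F" "(a', b') \<in> F" "lt a x" "lt x a'"
      by auto
    moreover from this have "lt a a'"
      using trans x FP unfolding transp_on_def by blast
    ultimately show "lt b b'"
      using hom unfolding setwise_def hom_pair_def by fastforce
  qed
  have sub: "?L \<subseteq> ?B" "?G \<subseteq> ?B"
    by auto
  have "\<exists>y\<in>P. y \<notin> ?B \<and> setwise lt ?L {y} \<and> setwise lt {y} ?G"
  proof -
    \<comment> \<open>If one side of the cut is empty, a point beyond all of \<open>?B\<close> meets
      the other side and avoids the range at once.\<close>
    consider "?L = {}" | "?G = {}" | "?L \<noteq> {}" "?G \<noteq> {}"
      by blast
    then show ?thesis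
    proof cases
      case 1
      obtain y where y: "y \<in> P" "setwise lt {y} ?B"
        using below[OF B small] by auto
      moreover from y have "y \<notin> ?B"
        using irrefl unfolding irreflp_on_def setwise_def by blast
      ultimately show ?thesis
        using 1 sub(2) unfolding setwise_def by blast
    next
      case 2
      obtain y where y: "y \<in> P" "setwise lt ?B {y}"
        using above[OF B small] by auto
      moreover from y have "y \<notin> ?B"
        using irrefl unfolding irreflp_on_def setwise_def by blast
      ultimately show ?thesis
        using 2 sub(1) unfolding setwise_def by blast
    next
      case 3
      text \<open>The members of the range in the interval are added to its upper bounds, so as to be avoided.\<close>
      let ?Q = "{q \<in> ?B. setwise lt ?L {q} \<and> setwise lt {q} ?G}"
      have "setwise lt ?L (?G \<union> ?Q)"
        using LG unfolding setwise_def by blast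
      moreover have QB: "?G \<union> ?Q \<subseteq> ?B"
        using sub by blast
      moreover have "?G \<union> ?Q \<noteq> {}"
        using 3(2) by blast
      ultimately obtain y where y: "y \<in> P" "setwise lt ?L {y}" "setwise lt {y} (?G \<union> ?Q)"
        using between[OF subset_trans[OF sub(1) B] subset_trans[OF QB B] small[OF sub(1)] small[OF QB] 3(1)]
        by blast
      \<comment> \<open>A member of \<open>?B\<close> inside the interval belongs to
        \<open>?Q\<close>, so \<open>y\<close> would lie below itself.\<close>
      moreover have "y \<notin> ?B"
      proof
        assume "y \<in> ?B"
        then have "y \<in> ?Q"
          using y unfolding setwise_def by blast
        then show False
          using y irrefl unfolding setwise_def irreflp_on_def by blast
      qed
      ultimately show ?thesis
        unfolding setwise_def by blast
    qed
  qed
  then obtain y where y: "y \<in> P" "y \<notin> ?B" "setwise lt ?L {y}" "setwise lt {y} ?G"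
    by blast
  have "setwise (hom_pair P lt) (insert (x, y) F) (insert (x, y) F)"
  proof (rule setwise_hom_pair_insert[OF hom irrefl x y(1)])
    fix a b assume "(a, b) \<in> F"
    then show "a \<noteq> x \<and> b \<noteq> y \<and> (lt a x \<longrightarrow> lt b y) \<and> (lt x a \<longrightarrow> lt y b)"
      using y False unfolding setwise_def by force
  qed
  then show ?thesis ..
qed

text \<open>With \<open>x\<close> incomparable to every point of the domain, the implications to be
  preserved have false premises. As \<open>incomparable\<close> refers to the reflexive closure,
  \<open>x\<close> is also new.\<close>

lemma hom_pair_back:
  assumes hom: "setwise (hom_pair P lt) F F" and card: "|F| <o |P|" and inf: "infinite P"
    and irrefl: "irreflp_on P lt"
    and free: "\<And>K. K \<subseteq> P \<Longrightarrow> |K| <o |P| \<Longrightarrow> K \<noteq> {} \<Longrightarrow> \<exists>r\<in>P. setwise (incomparable lt) {r} K"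
    and y: "y \<in> P"
  shows "\<exists>x. setwise (hom_pair P lt) (insert (x, y) F) (insert (x, y) F)"
proof (cases "y \<in> snd ` F")
  case True
  then obtain x where "(x, y) \<in> F"
    by force
  with hom show ?thesis
    by (metis insert_absorb)
next
  case False
  \<comment> \<open>Including \<open>y\<close> only serves to make the set nonempty, as
    \<open>free\<close> demands.\<close>
  let ?A = "{y} \<union> fst ` F"
  have "?A \<subseteq> P"
    using hom y by (auto simp: setwise_def hom_pair_def)
  moreover have "|fst ` F| <o |P|"
    using card card_of_image ordLeq_ordLess_trans by blast
  then have "|?A| <o |P|"
    using inf by (intro card_of_Un_ordLess_infinite) (auto simp: finite_card_less_infinite)
  ultimately obtain x where x: "x \<in> P" "setwise (incomparable lt) {x} ?A"
    using free[of ?A] by auto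
  have "setwise (hom_pair P lt) (insert (x, y) F) (insert (x, y) F)"
  proof (rule setwise_hom_pair_insert[OF hom irrefl x(1) y])
    fix a b assume "(a, b) \<in> F"
    then show "a \<noteq> x \<and> b \<noteq> y \<and> (lt a x \<longrightarrow> lt b y) \<and> (lt x a \<longrightarrow> lt y b)"
      using x False unfolding setwise_def incomparable_def by force
  qed
  then show ?thesis ..
qed

section \<open>From a total set of pairs to a bijection\<close>

text \<open>The biconditional in \<open>hom_pair\<close> makes \<open>F\<close> both single-valued
  and injective. Agreement with \<open>F\<close> is recorded so that the values at the initial pairs
  can be read off.\<close>

lemma bij_betw_of_hom_pair:
  assumes hom: "setwise (hom_pair P lt) F F" and dom: "P \<subseteq> fst ` F" and ran: "P \<subseteq> snd ` F"
  shows "\<exists>f. bij_betw f P P \<and> (\<forall>x\<in>P. \<forall>y\<in>P. lt x y \<longrightarrow> lt (f x) (f y))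
    \<and> (\<forall>(x, y)\<in>F. f x = y)"
proof -
  have FP: "F \<subseteq> P \<times> P"
    using hom by (auto simp: setwise_def hom_pair_def)
  have pair: "(a = c \<longleftrightarrow> b = d) \<and> (lt a c \<longrightarrow> lt b d)" if "(a, b) \<in> F" "(c, d) \<in> F" for a b c d
    using hom that unfolding setwise_def hom_pair_def by fastforce
  have "\<forall>x\<in>P. \<exists>y. (x, y) \<in> F"
    using dom by force
  then obtain f where f: "\<And>x. x \<in> P \<Longrightarrow> (x, f x) \<in> F"
    by metis
  have graph: "f x = y" if "(x, y) \<in> F" for x y
    using pair[OF that f] FP that by blast
  have "inj_on f P"
    unfolding inj_on_def using f pair by metis
  moreover have "f ` P = P"
  proof
    show "f ` P \<subseteq> P"
      using f FP by blast
    show "P \<subseteq> f ` P"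
    proof
      fix y assume "y \<in> P"
      then obtain x where "(x, y) \<in> F"
        using ran by force
      then show "y \<in> f ` P"
        using graph FP by blast
    qed
  qed
  ultimately have "bij_betw f P P"
    by (simp add: bij_betw_def)
  moreover have "\<forall>x\<in>P. \<forall>y\<in>P. lt x y \<longrightarrow> lt (f x) (f y)"
    using f pair by blast
  ultimately show ?thesis
    using graph by blast
qed

section \<open>A bijective endomorphism that is not an automorphism\<close>

theorem theorem4p1:
  fixes P :: "'a set" and lt :: "'a \<Rightarrow> 'a \<Rightarrow> bool" and \<kappa> :: "'k rel"
  assumes "strict_partial_order P lt"
    and "Cinfinite \<kappa>" and "regularCard \<kappa>" and "|P| =o \<kappa>"
    and u1: "\<And>L G. L \<in> subsets_less P \<kappa> - {{}} \<Longrightarrow> G \<in> subsets_less P \<kappa> - {{}} \<Longrightarrow> setwise lt L G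
      \<Longrightarrow> \<exists>p\<in>P. setwise lt L {p} \<and> setwise lt {p} G"
    and u2: "\<And>K. K \<in> subsets_less P \<kappa> - {{}}
      \<Longrightarrow> \<exists>p\<in>P. \<exists>q\<in>P. \<exists>r\<in>P. setwise lt {p} K \<and> setwise lt K {q}
            \<and> setwise (incomparable lt) {r} K"
  shows "\<not> reversible P lt"
proof
  assume rev: "reversible P lt"
  have irrefl: "irreflp_on P lt" and trans: "transp_on P lt"
    using assms(1) by (auto simp: strict_partial_order_def)
  have inf: "infinite P"
    using assms(2,4) card_of_ordIso_finite_Field ordIso_symmetric unfolding cinfinite_def by blast
  \<comment> \<open>Smallness is restated relative to \<open>|P|\<close>, the bound used in the
    extension lemmas.\<close>
  have sl: "A \<in> subsets_less P \<kappa> - {{}} \<longleftrightarrow> A \<subseteq> P \<and> |A| <o |P| \<and> A \<noteq> {}" for A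
    using ordLess_ordIso_trans[OF _ assms(4)] ordLess_ordIso_trans[OF _ ordIso_symmetric[OF assms(4)]]
    by (auto simp: subsets_less_def)
  note between = u1[unfolded sl] and unbounded = u2[unfolded sl]
  obtain d where d: "d \<in> P"
    using inf by fastforce
  obtain c b where cb: "c \<in> P" "lt c d" "b \<in> P" "incomparable lt b d"
    using unbounded[of "{d}"] d inf by (auto simp: setwise_def finite_card_less_infinite)
  let ?F0 = "{(b, c), (d, d)}"
  \<comment> \<open>Incomparability gives \<open>b \<noteq> d\<close>, and \<open>c < d\<close>
    gives \<open>c \<noteq> d\<close>; neither \<open>b < d\<close> nor \<open>d < b\<close> holds,
    so there is nothing to preserve.\<close>
  have base: "setwise (hom_pair P lt) ?F0 ?F0"
    using cb d irrefl unfolding setwise_def hom_pair_def incomparable_def irreflp_on_def by auto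
  \<comment> \<open>The turn of \<open>x\<close> first puts \<open>x\<close> into the domain, then
    into the range; \<open>S\<close> consists of the two pairs \<open>(x, y)\<close> and
    \<open>(z, x)\<close>.\<close>
  have step: "\<exists>S. finite S \<and> setwise (hom_pair P lt) (F \<union> S) (F \<union> S) \<and> x \<in> fst ` S \<and> x \<in> snd ` S"
    if x: "x \<in> P" and F: "setwise (hom_pair P lt) F F" "|F| <o |P|" for x F
  proof -
    obtain y where y: "setwise (hom_pair P lt) (insert (x, y) F) (insert (x, y) F)"
    proof -
      have "\<exists>y. setwise (hom_pair P lt) (insert (x, y) F) (insert (x, y) F)"
        by (rule hom_pair_forth[OF F inf irrefl trans _ _ _ x]) (use between unbounded in blast)+
      then show thesis
        using that by blast
    qed
    have "|{(x, y)} \<union> F| <o |P|"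
      using inf F by (intro card_of_Un_ordLess_infinite) (auto simp: finite_card_less_infinite)
    then have "\<exists>z. setwise (hom_pair P lt) (insert (z, x) (insert (x, y) F)) (insert (z, x) (insert (x, y) F))"
      by (intro hom_pair_back[OF y _ inf irrefl _ x]) (use unbounded in \<open>simp, blast\<close>)
    then obtain z where
      "setwise (hom_pair P lt) (insert (z, x) (insert (x, y) F)) (insert (z, x) (insert (x, y) F))"
      by blast
    then show ?thesis
      by (intro exI[of _ "{(z, x), (x, y)}"]) (simp add: Un_insert_right)
  qed
  obtain F where F: "?F0 \<subseteq> F" "setwise (hom_pair P lt) F F"
      "\<forall>x\<in>P. \<exists>S\<subseteq>F. x \<in> fst ` S \<and> x \<in> snd ` S"
  proof -
    have "\<exists>F. ?F0 \<subseteq> F \<and> setwise (hom_pair P lt) F F \<and> (\<forall>x\<in>P. \<exists>S\<subseteq>F. x \<in> fst ` S \<and> x \<in> snd ` S)"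
      by (rule transfinite_pairwise_extension[OF inf _ step base]) auto
    then show thesis
      using that by blast
  qed
  from F(3) have "P \<subseteq> fst ` F" "P \<subseteq> snd ` F"
    by blast+
  with F(2) obtain f where f: "bij_betw f P P" "\<forall>x\<in>P. \<forall>y\<in>P. lt x y \<longrightarrow> lt (f x) (f y)"
      "\<forall>(x, y)\<in>F. f x = y"
    using bij_betw_of_hom_pair by blast
  \<comment> \<open>Reversibility would make \<open>f\<close> reflect \<open>c < d\<close> back to
    \<open>b < d\<close>, against the choice of \<open>b\<close>.\<close>
  then have "lt b d \<longleftrightarrow> lt (f b) (f d)"
    using rev cb d unfolding reversible_def automorphism_def by blast
  moreover have "f b = c" "f d = d"
    using f(3) F(1) by auto
  ultimately show False
    using cb by (auto simp: incomparable_def)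
qed

end
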